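(* Let $(a_n)_{n\ge 0}$ be the sequence defined by $a_0=1$ and $a_n-a_{n-1}=2^{2n}$ for all $n\ge 1$. Then $a_n=\frac{1}{3}\left[4^{n+1}-1\right]$ for all $n\ge 0$; for every odd number in the set $\{a_n : n\ge 0\}$, repeated application of the Collatz function $f$ eventually reaches $1$; and for each $n\ge 0$ the number of Collatz function operations needed to get $1$ from $a_n$ is $N_{a_n}=2n+3$.
   Context: The Collatz function $f:\mathbb{Z}_{\ge 1}\to\mathbb{Z}_{\ge 1}$ is defined by $f(n)=n/2$ if $n$ is even and $f(n)=3n+1$ if $n$ is odd. For a positive integer $k$, $N_k$ denotes the number of Collatz function operations for the number $k$ to get $1$, i.e. the least integer $m\ge 1$ such that the $m$-fold iterate satisfies $f^{m}(k)=1$ (so that $N_1=3$, via $1\to 4\to 2\to 1$), with $N_k=\infty$ if there is no such $m$. *)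

theory Defs
  imports Complex_Main "HOL-Library.Extended_Nat"
begin

(* The Collatz map lives on the positive integers, which it maps to themselves;
   its values at arguments below 1 are irrelevant. *)
definition collatz :: "int \<Rightarrow> int" where
  "collatz n = (if even n then n div 2 else 3 * n + 1)"

(* At least one application is required, so the count for 1 is 3 (1, 4, 2, 1), not 0. *)
definition collatz_steps :: "int \<Rightarrow> enat" where
  "collatz_steps k =
     (if \<exists>m\<ge>1. (collatz ^^ m) k = 1
      then enat (LEAST m. m \<ge> 1 \<and> (collatz ^^ m) k = 1)
      else \<infinity>)"

end

theory Submission imports Defs begin

text \<open>
  The recurrence makes \<open>a n\<close> the geometric sum \<open>1 + 4 + \<dots> + 4 ^ n\<close>, that is,
  \<open>3 * a n + 1 = 2 ^ (2 * n + 2)\<close>. Hence \<open>a n\<close> is odd, and its first Collatz operation already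
  lands on a power of two. From there on every operation is a halving, so the orbit is forced:
  it takes \<open>2 * n + 2\<close> more operations to come down to 1, and every earlier value is a larger
  power of two, so 1 does not occur sooner. The count belongs to any odd number \<open>k\<close> for which
  \<open>3 * k + 1\<close> is a power of two (\<open>collatz_steps_if_3k1_power_of_2\<close>).
\<close>

lemma collatz_funpow_power_of_2:
  "j \<le> e \<Longrightarrow> (collatz ^^ j) (2 ^ e) = 2 ^ (e - j)"
proof (induction j)
  case 0
  then show ?case by simp
next
  case (Suc j)
  then have "e - j = Suc (e - Suc j)" by simp
  with Suc show ?case by (simp add: collatz_def)
qed

text \<open>
  After the first operation the exponent drops by one each time, so the value is 1 exactly when
  the exponent has been used up. The starting value is not examined, in accordance with the
  convention that at least one operation is applied; this is why \<open>k = 1\<close>, with \<open>e = 2\<close>, is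
  no exception and gets the count 3.
\<close>

lemma collatz_steps_if_3k1_power_of_2:
  assumes "odd k" and "3 * k + 1 = 2 ^ e"
  shows "collatz_steps k = enat (Suc e)"
proof -
  have orbit: "(collatz ^^ Suc j) k = 2 ^ (e - j)" if "j \<le> e" for j
    using assms that
    by (simp add: funpow_Suc_right collatz_def collatz_funpow_power_of_2 del: funpow.simps)
  have reach: "(collatz ^^ Suc e) k = 1"
    using orbit[of e] by simp
  have "(LEAST m. m \<ge> 1 \<and> (collatz ^^ m) k = 1) = Suc e"
  proof (rule Least_equality)
    show "Suc e \<ge> 1 \<and> (collatz ^^ Suc e) k = 1"
      using reach by simp
  next
    fix m assume m: "m \<ge> 1 \<and> (collatz ^^ m) k = 1"
    then obtain j where j: "m = Suc j" by (cases m) auto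
    show "Suc e \<le> m"
    proof (rule ccontr)
      assume "\<not> Suc e \<le> m"
      with j have "j < e" by simp
      with orbit[of j] have "(collatz ^^ m) k = 2 ^ (e - j)" by (simp add: j del: funpow.simps)
      moreover have "(2::int) ^ (e - j) > 1"
        using \<open>j < e\<close> by (intro one_less_power) auto
      ultimately show False using m by simp
    qed
  qed
  moreover have "\<exists>m\<ge>1. (collatz ^^ m) k = 1"
    using reach by (intro exI[of _ "Suc e"]) (simp del: funpow.simps)
  ultimately show ?thesis by (simp add: collatz_steps_def)
qed

theorem theorem1:
  fixes a :: "nat \<Rightarrow> int"
  assumes "a 0 = 1"
    and "\<And>n. n \<ge> 1 \<Longrightarrow> a n - a (n - 1) = 2 ^ (2 * n)"
  shows "(\<forall>n. real_of_int (a n) = 1 / 3 * (4 ^ (n + 1) - 1))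
    \<and> (\<forall>k \<in> {a n | n. n \<ge> 0}. odd k \<longrightarrow> (\<exists>m\<ge>1. (collatz ^^ m) k = 1))
    \<and> (\<forall>n. collatz_steps (a n) = enat (2 * n + 3))"
proof -
  have sum4: "3 * a n + 1 = 4 ^ (n + 1)" for n
  proof (induction n)
    case 0
    then show ?case using assms(1) by simp
  next
    case (Suc n)
    have "a (Suc n) = a n + 4 ^ Suc n"
      using assms(2)[of "Suc n"] by (simp add: power_mult)
    with Suc show ?case by simp
  qed
  have closed_form: "real_of_int (a n) = 1 / 3 * (4 ^ (n + 1) - 1)" for n
  proof -
    have "real_of_int (3 * a n + 1) = 4 ^ (n + 1)"
      by (simp only: sum4 of_int_power of_int_numeral)
    then show ?thesis by simp
  qed
  have steps: "collatz_steps (a n) = enat (2 * n + 3)" for n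
  proof -
    have pow2: "3 * a n + 1 = 2 ^ (2 * n + 2)"
      using sum4[of n] by (simp add: power_mult power_add)
    then have "even (3 * a n + 1)" by simp
    then have "odd (a n)" by simp
    from collatz_steps_if_3k1_power_of_2[OF this pow2] show ?thesis
      by (simp add: numeral_3_eq_3)
  qed
  \<comment> \<open>A finite count already says that 1 is reached.\<close>
  have "\<exists>m\<ge>1. (collatz ^^ m) (a n) = 1" for n
    using steps[of n] by (auto simp: collatz_steps_def split: if_splits)
  with closed_form steps show ?thesis by blast
qed

end
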